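(* For every class of valuations that contains all additive valuations, the price of anarchy of NOB-feasible pure Nash equilibria of budget-free simultaneous second-price auctions with valuations from this class is at least $2$. That is, the supremum of $\mathrm{OPT}(I)/\mathrm{LW}(I,a)$ over budget-free instances $I$ with valuations from the class and NOB-feasible pure Nash equilibria $a$ of $I$ is at least $2$.
   Context: Simultaneous second-price auction: bidders $N=[n]$, $n\ge2$; items $M=[m]$, $m\ge1$. Bidder $i$ submits $a_i=(a_{ij})_{j\in M}\in\mathbb R_{\ge0}^m$. Each item $j$ is awarded to exactly one bidder among those with the highest bid on $j$, ties being resolved by a fixed order over bidders (part of the instance); $X_i(a)\subseteq M$ is the set of items won by $i$, and $i$ pays $P_i(a)=\sum_{j\in X_i(a)}\max_{\ell\ne i}a_{\ell j}$. Bidder $i$ has a monotone valuation $v_i:2^M\to\mathbb R_{\ge0}$, $v_i(\emptyset)=0$; $v_i$ is additive if $v_i(S)=\sum_{j\in S}v_{ij}$ for some $v_{ij}\ge0$. Budget-free means all budgets are infinite. Utility: $u_i(a)=v_i(X_i(a))-P_i(a)$. A pure Nash equilibrium is a bid profile $a$ with $u_i(a)\ge u_i(a_i',a_{-i})$ for all $i$ and all $a_i'\in\mathbb R_{\ge0}^m$. In the budget-free case the liquid welfare is $\mathrm{LW}(I,a)=\sum_iv_i(X_i(a))$, and $\mathrm{OPT}(I)$ is the maximum of $\sum_iv_i(x_i)$ over profiles $(x_i)_{i\in N}$ of pairwise disjoint subsets of $M$. NOB (no overbidding): let $W_i(a)=\sup\{P_i(a_i,a_{-i}'):X_i(a_i,a_{-i}')=X_i(a)\}$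 (here $W_i(a)=\sum_{j\in X_i(a)}a_{ij}$). $a$ is NOB-feasible if $\sum_iW_i(a)\le\mathrm{LW}(I,a)$. Deviations are not restricted by NOB. *)

theory Defs
  imports Complex_Main "HOL-Library.FuncSet" "HOL-Library.Disjoint_Sets"
    "HOL-Library.Extended_Real"
begin

text \<open>A valuation over \<open>m\<close> items is a function on the subsets of \<open>{1..m}\<close>. It is represented by an
  extensional HOL function, so that a class of valuations cannot depend on values outside this
  domain.\<close>

definition valuations :: "nat \<Rightarrow> (nat set \<Rightarrow> real) set" where
  "valuations m = {v \<in> Pow {1..m} \<rightarrow>\<^sub>E {0..}.
     v {} = 0 \<and> (\<forall>S T. S \<subseteq> T \<and> T \<subseteq> {1..m} \<longrightarrow> v S \<le> v T)}"

definition additive_valuations :: "nat \<Rightarrow> (nat set \<Rightarrow> real) set" where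
  "additive_valuations m = {v \<in> valuations m.
     \<exists>w. (\<forall>j\<in>{1..m}. 0 \<le> w j) \<and> (\<forall>S. S \<subseteq> {1..m} \<longrightarrow> v S = (\<Sum>j\<in>S. w j))}"

text \<open>A class of valuations prescribes a set of valuations for every number of items.\<close>

definition valuation_class :: "(nat \<Rightarrow> (nat set \<Rightarrow> real) set) \<Rightarrow> bool" where
  "valuation_class C \<longleftrightarrow> (\<forall>m\<ge>1. C m \<subseteq> valuations m)"

text \<open>A budget-free instance. All budgets are infinite, so they are not recorded.
  \<open>(i, l) \<in> tie_order I\<close> means that bidder \<open>i\<close> has priority over bidder \<open>l\<close> in ties
  (the order is reflexive).\<close>

record auction =
  num_bidders :: nat
  num_items :: nat
  tie_order :: "nat rel"
  val :: "nat \<Rightarrow> nat set \<Rightarrow> real"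

definition bidders :: "auction \<Rightarrow> nat set" where
  "bidders I = {1..num_bidders I}"

definition items :: "auction \<Rightarrow> nat set" where
  "items I = {1..num_items I}"

definition budget_free_instance :: "auction \<Rightarrow> bool" where
  "budget_free_instance I \<longleftrightarrow>
     num_bidders I \<ge> 2 \<and> num_items I \<ge> 1 \<and> linear_order_on (bidders I) (tie_order I) \<and>
     (\<forall>i\<in>bidders I. val I i \<in> valuations (num_items I))"

text \<open>\<open>a i j\<close> is the bid of bidder \<open>i\<close> on item \<open>j\<close>; entries outside \<open>bidders I\<close> and \<open>items I\<close>
  are never inspected.\<close>

definition bids :: "auction \<Rightarrow> (nat \<Rightarrow> real) set" where
  "bids I = {b. \<forall>j\<in>items I. 0 \<le> b j}"

definition bid_profiles :: "auction \<Rightarrow> (nat \<Rightarrow> nat \<Rightarrow> real) set" where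
  "bid_profiles I = {a. \<forall>i\<in>bidders I. a i \<in> bids I}"

definition won :: "auction \<Rightarrow> (nat \<Rightarrow> nat \<Rightarrow> real) \<Rightarrow> nat \<Rightarrow> nat set" where
  "won I a i = {j \<in> items I. \<forall>l\<in>bidders I.
     a l j \<le> a i j \<and> (a l j = a i j \<longrightarrow> (i, l) \<in> tie_order I)}"

definition payment :: "auction \<Rightarrow> (nat \<Rightarrow> nat \<Rightarrow> real) \<Rightarrow> nat \<Rightarrow> real" where
  "payment I a i = (\<Sum>j\<in>won I a i. Max ((\<lambda>l. a l j) ` (bidders I - {i})))"

definition utility :: "auction \<Rightarrow> (nat \<Rightarrow> nat \<Rightarrow> real) \<Rightarrow> nat \<Rightarrow> real" where
  "utility I a i = val I i (won I a i) - payment I a i"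

definition pure_nash :: "auction \<Rightarrow> (nat \<Rightarrow> nat \<Rightarrow> real) \<Rightarrow> bool" where
  "pure_nash I a \<longleftrightarrow> a \<in> bid_profiles I \<and>
     (\<forall>i\<in>bidders I. \<forall>b\<in>bids I. utility I (a(i := b)) i \<le> utility I a i)"

definition liquid_welfare :: "auction \<Rightarrow> (nat \<Rightarrow> nat \<Rightarrow> real) \<Rightarrow> real" where
  "liquid_welfare I a = (\<Sum>i\<in>bidders I. val I i (won I a i))"

definition opt :: "auction \<Rightarrow> real" where
  "opt I = Max ((\<lambda>x. \<Sum>i\<in>bidders I. val I i (x i)) `
     {x \<in> bidders I \<rightarrow>\<^sub>E Pow (items I). disjoint_family_on x (bidders I)})"

text \<open>The set below contains \<open>payment I a i\<close> and is bounded above by the sum of the bids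
  \<open>a i j\<close> over \<open>j \<in> won I a i\<close>, so the real supremum is a genuine one.\<close>

definition max_payment :: "auction \<Rightarrow> (nat \<Rightarrow> nat \<Rightarrow> real) \<Rightarrow> nat \<Rightarrow> real" where
  "max_payment I a i = Sup {payment I (a'(i := a i)) i | a'.
     a' \<in> bid_profiles I \<and> won I (a'(i := a i)) i = won I a i}"

definition nob_feasible :: "auction \<Rightarrow> (nat \<Rightarrow> nat \<Rightarrow> real) \<Rightarrow> bool" where
  "nob_feasible I a \<longleftrightarrow> (\<Sum>i\<in>bidders I. max_payment I a i) \<le> liquid_welfare I a"

text \<open>The ratio is taken in the extended reals, where \<open>x / 0 = \<infinity>\<close> for \<open>x > 0\<close> and \<open>0 / 0 = 0\<close>;
  in particular a degenerate instance with zero optimum does not affect lower bounds on the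
  supremum.\<close>

definition nob_price_of_anarchy :: "(nat \<Rightarrow> (nat set \<Rightarrow> real) set) \<Rightarrow> ereal" where
  "nob_price_of_anarchy C = Sup {ereal (opt I) / ereal (liquid_welfare I a) | I a.
     budget_free_instance I \<and> (\<forall>i\<in>bidders I. val I i \<in> C (num_items I)) \<and>
     pure_nash I a \<and> nob_feasible I a}"

end

theory Submission
  imports Defs
begin

text \<open>Two bidders, two items; bidder 1 values only item 2 (at 1) and bidder 2 values only item 1
  (at 1). Bidder 1 bids 1 on item 1 and 0 on item 2, bidder 2 bids 0 on both, and ties favour
  bidder 1, who thus wins everything for free. Bidder 2 cannot gain, since the bids of bidder 1
  equal the values of bidder 2. Bidder 1 overbids on item 1, but no overbidding only constrains the
  total of the winning bids, which is 1, as is the welfare. The optimum gives each bidder the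
  desired item and has welfare 2.\<close>

text \<open>The restriction to subsets of the item set makes the function extensional, as
  \<open>valuations\<close> demands.\<close>

definition additive_val :: "nat \<Rightarrow> (nat \<Rightarrow> real) \<Rightarrow> nat set \<Rightarrow> real" where
  "additive_val m w = restrict (sum w) (Pow {1..m})"

lemma additive_val_apply [simp]: "S \<subseteq> {1..m} \<Longrightarrow> additive_val m w S = sum w S"
  by (simp add: additive_val_def)

lemma additive_val_in_additive_valuations:
  assumes "\<forall>j\<in>{1..m}. 0 \<le> w j"
  shows "additive_val m w \<in> additive_valuations m"
proof -
  have "sum w S \<le> sum w T" if "S \<subseteq> T" "T \<subseteq> {1..m}" for S T
    using that assms by (intro sum_mono2) (auto intro: finite_subset)
  moreover have "0 \<le> sum w S" if "S \<subseteq> {1..m}" for S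
    using that assms by (intro sum_nonneg) auto
  ultimately have "additive_val m w \<in> valuations m"
    by (auto simp: valuations_def additive_val_def)
  then show ?thesis
    using assms unfolding additive_valuations_def by auto
qed

lemma won_subset_items: "won I a i \<subseteq> items I"
  by (auto simp: won_def)

text \<open>Extensionality leaves only finitely many allocations, so \<open>Max\<close> is attained
  and bounds each of them.\<close>

lemma opt_ge:
  assumes "x \<in> bidders I \<rightarrow>\<^sub>E Pow (items I)" "disjoint_family_on x (bidders I)"
  shows "(\<Sum>i\<in>bidders I. val I i (x i)) \<le> opt I"
proof -
  have "finite (bidders I \<rightarrow>\<^sub>E Pow (items I))"
    by (intro finite_PiE) (auto simp: bidders_def items_def)
  then show ?thesis
    unfolding opt_def using assms by (intro Max_ge) auto
qed

lemma nob_price_of_anarchy_ge: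
  assumes "budget_free_instance I" "\<forall>i\<in>bidders I. val I i \<in> C (num_items I)"
    and "pure_nash I a" "nob_feasible I a"
  shows "ereal (opt I) / ereal (liquid_welfare I a) \<le> nob_price_of_anarchy C"
  unfolding nob_price_of_anarchy_def using assms by (intro Sup_upper) blast

definition swap_weight :: "nat \<Rightarrow> nat \<Rightarrow> real" where
  "swap_weight i j = (if i = j then 0 else 1)"

definition swap_auction :: auction where
  "swap_auction = \<lparr>num_bidders = 2, num_items = 2, tie_order = {(1,1), (1,2), (2,2)},
     val = \<lambda>i. additive_val 2 (swap_weight i)\<rparr>"

definition swap_bids :: "nat \<Rightarrow> nat \<Rightarrow> real" where
  "swap_bids i j = (if i = 1 \<and> j = 1 then 1 else 0)"

lemma bidders_swap: "bidders swap_auction = {1, 2}"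
  and items_swap: "items swap_auction = {1, 2}"
  by (auto simp: bidders_def items_def swap_auction_def)

lemma val_swap: "S \<subseteq> {1, 2} \<Longrightarrow> val swap_auction i S = sum (swap_weight i) S"
  unfolding swap_auction_def by (simp, subst additive_val_apply) auto

lemma val_swap_won:
  "val swap_auction i (won swap_auction a i) = sum (swap_weight i) (won swap_auction a i)"
  using won_subset_items[of swap_auction a i] by (simp add: val_swap items_swap)

text \<open>With two bidders, the highest competing bid is that of the single opponent.\<close>

lemma payment_swap:
  "payment swap_auction a 1 = sum (a 2) (won swap_auction a 1)"
  "payment swap_auction a 2 = sum (a 1) (won swap_auction a 2)"
proof -
  have "{1, 2} - {1} = {2::nat}" "{1, 2} - {2} = {1::nat}" by auto
  then show "payment swap_auction a 1 = sum (a 2) (won swap_auction a 1)"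
    "payment swap_auction a 2 = sum (a 1) (won swap_auction a 2)"
    by (simp_all only: payment_def bidders_swap) simp_all
qed

lemma won_swap_bids:
  "won swap_auction swap_bids 1 = {1, 2}" "won swap_auction swap_bids 2 = {}"
  unfolding won_def bidders_swap items_swap
  by (auto simp: swap_auction_def swap_bids_def)

lemma liquid_welfare_swap: "liquid_welfare swap_auction swap_bids = 1"
  by (simp add: liquid_welfare_def bidders_swap val_swap_won won_swap_bids[simplified]
      swap_weight_def)

lemma val_swap_in_additive_valuations: "val swap_auction i \<in> additive_valuations 2"
  by (simp add: swap_auction_def additive_val_in_additive_valuations swap_weight_def)

lemma budget_free_swap: "budget_free_instance swap_auction"
proof -
  have "val swap_auction i \<in> valuations (num_items swap_auction)" for i
    using val_swap_in_additive_valuations[of i]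
    by (simp add: additive_valuations_def swap_auction_def)
  moreover have "linear_order_on (bidders swap_auction) (tie_order swap_auction)"
    unfolding bidders_swap
    by (auto simp: swap_auction_def linear_order_on_def partial_order_on_def preorder_on_def
        refl_on_def trans_def antisym_def total_on_def)
  ultimately show ?thesis
    by (simp add: budget_free_instance_def swap_auction_def)
qed

lemma pure_nash_swap: "pure_nash swap_auction swap_bids"
proof -
  \<comment> \<open>Bidder 2 bids 0 everywhere, so every deviation of bidder 1 is free and yields
    the value of the set won, which is largest for both items.\<close>
  have "utility swap_auction (swap_bids(1 := b)) 1 \<le> utility swap_auction swap_bids 1" for b
  proof -
    have "sum (swap_weight 1) (won swap_auction (swap_bids(1 := b)) 1)
        \<le> sum (swap_weight 1) {1, 2}"
      using won_subset_items[of swap_auction]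
      by (intro sum_mono2) (auto simp: items_swap swap_weight_def)
    then show ?thesis
      unfolding utility_def val_swap_won payment_swap
      unfolding won_swap_bids
      by (simp add: swap_bids_def)
  qed
  moreover
  \<comment> \<open>The bids of bidder 1 coincide with the weights of bidder 2, so whatever bidder 2
    wins costs exactly its value: every deviation has utility 0.\<close>
  have "utility swap_auction (swap_bids(2 := b)) 2 \<le> utility swap_auction swap_bids 2" for b
  proof -
    have "sum (swap_weight 2) (won swap_auction (swap_bids(2 := b)) 2)
        = sum (swap_bids 1) (won swap_auction (swap_bids(2 := b)) 2)"
      using won_subset_items[of swap_auction "swap_bids(2 := b)" 2]
      by (intro sum.cong) (auto simp: items_swap swap_weight_def swap_bids_def)
    then show ?thesis
      unfolding utility_def val_swap_won payment_swap
      unfolding won_swap_bids by simp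
  qed
  moreover have "swap_bids \<in> bid_profiles swap_auction"
    by (simp add: bid_profiles_def bids_def swap_bids_def)
  ultimately show ?thesis
    unfolding pure_nash_def bidders_swap by blast
qed

text \<open>A real supremum is at most any upper bound of a nonempty set; the profile
  \<open>a\<close> itself supplies the required element.\<close>

lemma max_payment_le:
  assumes "a \<in> bid_profiles I"
    and "\<And>a'. a' \<in> bid_profiles I \<Longrightarrow> won I (a'(i := a i)) i = won I a i
      \<Longrightarrow> payment I (a'(i := a i)) i \<le> c"
  shows "max_payment I a i \<le> c"
  unfolding max_payment_def
proof (rule cSup_least)
  show "{payment I (a'(i := a i)) i | a'.
      a' \<in> bid_profiles I \<and> won I (a'(i := a i)) i = won I a i} \<noteq> {}"
    using assms(1) fun_upd_triv[of a i] by fastforce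
qed (use assms(2) in auto)

lemma nob_feasible_swap: "nob_feasible swap_auction swap_bids"
proof -
  have profile: "swap_bids \<in> bid_profiles swap_auction"
    using pure_nash_swap by (simp add: pure_nash_def)
  have "max_payment swap_auction swap_bids 1 \<le> 1"
  proof (rule max_payment_le[OF profile])
    fix a'
    assume won: "won swap_auction (a'(1 := swap_bids 1)) 1 = won swap_auction swap_bids 1"
    then have "1 \<in> won swap_auction (a'(1 := swap_bids 1)) 1"
      "2 \<in> won swap_auction (a'(1 := swap_bids 1)) 1"
      unfolding won_swap_bids by auto
    \<comment> \<open>Keeping both items caps the opponent's bids by those of bidder 1, namely 1 and
      0. The payment is thus at most 1, which is the whole welfare.\<close>
    then have "a' 2 1 \<le> 1" "a' 2 2 \<le> 0"
      unfolding won_def bidders_swap by (auto simp: swap_bids_def)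
    then show "payment swap_auction (a'(1 := swap_bids 1)) 1 \<le> 1"
      unfolding payment_swap won won_swap_bids by simp
  qed
  \<comment> \<open>Bidder 2 wins the empty set, so the payment is an empty sum for every admissible
    \<open>a'\<close>.\<close>
  moreover have "max_payment swap_auction swap_bids 2 \<le> 0"
    by (rule max_payment_le[OF profile]) (simp add: payment_swap won_swap_bids)
  ultimately show ?thesis
    by (simp add: nob_feasible_def bidders_swap liquid_welfare_swap)
qed

lemma opt_swap_ge: "2 \<le> opt swap_auction"
proof -
  \<comment> \<open>The map \<open>3 - i\<close> exchanges 1 and 2, so each bidder receives the one
    item of weight 1.\<close>
  define x :: "nat \<Rightarrow> nat set" where "x = (\<lambda>i\<in>{1, 2}. {3 - i})"
  have "(\<Sum>i\<in>bidders swap_auction. val swap_auction i (x i)) \<le> opt swap_auction"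
    by (rule opt_ge) (auto simp: x_def bidders_swap items_swap disjoint_family_on_def)
  then show ?thesis
    by (simp add: bidders_swap x_def val_swap swap_weight_def)
qed

theorem theorem4p6:
  fixes C :: "nat \<Rightarrow> (nat set \<Rightarrow> real) set"
  assumes "valuation_class C"
    and "\<forall>m\<ge>1. additive_valuations m \<subseteq> C m"
  shows "nob_price_of_anarchy C \<ge> 2"
proof -
  have "num_items swap_auction = 2"
    by (simp add: swap_auction_def)
  moreover have "additive_valuations 2 \<subseteq> C 2"
    using assms(2) by simp
  ultimately have "\<forall>i\<in>bidders swap_auction. val swap_auction i \<in> C (num_items swap_auction)"
    using val_swap_in_additive_valuations by auto
  then have "ereal (opt swap_auction) / ereal (liquid_welfare swap_auction swap_bids)
      \<le> nob_price_of_anarchy C"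
    by (rule nob_price_of_anarchy_ge[OF budget_free_swap _ pure_nash_swap nob_feasible_swap])
  \<comment> \<open>The equilibrium welfare is 1, so the ratio is the optimum itself.\<close>
  then have "ereal (opt swap_auction) \<le> nob_price_of_anarchy C"
    by (simp add: liquid_welfare_swap one_ereal_def[symmetric])
  moreover have "2 \<le> ereal (opt swap_auction)"
    using opt_swap_ge by simp
  ultimately show ?thesis
    by (rule order_trans[rotated])
qed

end
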